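(* Let $t\geq2$ be an integer, let $A$ be a non-empty subset of $[0,1]$, and let $\psi:\mathbb{N}\to(0,\infty)$ be any function. Then for every real $s>0$, $$\mathcal{H}^{s}(W_{t}(\psi)\cap A)=0\quad\text{if}\quad\sum_{n=1}^{\infty}\psi(n)^{s}N_{t^{-n}}(A)<\infty.$$
   Context: $W_{t}(\psi)=\{x\in[0,1]: |x-p/t^{n}|<\psi(n)\text{ for infinitely many }(p,n)\in\mathbb{Z}\times\mathbb{N}\}$. For $\delta>0$, $N_{\delta}(A)$ is the smallest number of sets of diameter at most $\delta$ which cover $A$. $\mathcal{H}^{s}$ is $s$-dimensional Hausdorff measure. *)

theory Defs
  imports "HOL-Analysis.Analysis"
begin

text \<open>
  Here \<open>\<nat> = {1, 2, \<dots>}\<close>, so only the values \<open>\<psi> n\<close> with \<open>n \<ge> 1\<close> matter. It is the pairs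
  \<open>(p, n)\<close> that are counted, not the rationals \<open>p / t ^ n\<close>; \<open>p\<close> and \<open>t\<close> need not be coprime.
\<close>

definition W :: "int \<Rightarrow> (nat \<Rightarrow> real) \<Rightarrow> real set" where
  "W t \<psi> = {x \<in> {0..1}.
     infinite {(p :: int, n :: nat). n \<ge> 1 \<and> \<bar>x - of_int p / of_int t ^ n\<bar> < \<psi> n}}"

text \<open>
  Boundedness is required because \<^const>\<open>diameter\<close> is unspecified on unbounded sets. The
  infimum is over a non-empty set of naturals, hence a minimum, when \<open>A\<close> is totally bounded
  and \<open>\<delta> > 0\<close>; otherwise the value is meaningless (a default 0).
\<close>

definition covering_number :: "real \<Rightarrow> 'a::metric_space set \<Rightarrow> nat" where
  "covering_number \<delta> A = Inf {card F | F :: 'a set set.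
     finite F \<and> A \<subseteq> \<Union>F \<and> (\<forall>U\<in>F. bounded U \<and> diameter U \<le> \<delta>)}"

text \<open>
  Hausdorff (outer) measure without normalising constant, for exponents \<open>s > 0\<close> only: at
  \<open>s = 0\<close> the convention \<open>0 powr 0 = 0\<close> would give singletons weight 0. Finite covers
  are included, since the sets \<open>U i\<close> may be empty and \<open>diameter {} = 0\<close>.
\<close>

definition hausdorff_premeasure :: "real \<Rightarrow> real \<Rightarrow> 'a::metric_space set \<Rightarrow> ennreal" where
  "hausdorff_premeasure s \<delta> A = Inf {(\<Sum>i. ennreal (diameter (U i) powr s)) | U :: nat \<Rightarrow> 'a set.
     A \<subseteq> (\<Union>i. U i) \<and> (\<forall>i. bounded (U i) \<and> diameter (U i) \<le> \<delta>)}"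

definition hausdorff_measure :: "real \<Rightarrow> 'a::metric_space set \<Rightarrow> ennreal" where
  "hausdorff_measure s A = (SUP \<delta>\<in>{0<..}. hausdorff_premeasure s \<delta> A)"

end

theory Submission
  imports Defs
begin

text \<open>
  A set in a cover of \<open>A\<close> at scale \<open>t\<^sup>-\<^sup>n\<close> meets at most four of the intervals of radius
  \<open>\<psi> n < t\<^sup>-\<^sup>n\<close> about the points \<open>p / t\<^sup>n\<close>; if \<open>\<psi> n \<ge> t\<^sup>-\<^sup>n\<close>, the set itself is small
  enough. So the \<open>n\<close>-th level of the limsup set, intersected with \<open>A\<close>, is covered by
  \<open>4 N\<close> sets of diameter at most \<open>2 \<psi> n\<close>, and the Hausdorff--Cantelli lemma applies.
\<close>

text \<open>The premeasure ranges over sequences of sets, while the later constructions yield a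
  finite family for each level. Enumerating each family, padding it with \<open>{}\<close> and
  flattening the double sequence by \<open>prod_decode\<close> turns one kind of cover into the
  other.\<close>

lemma hausdorff_premeasure_le_suminf_finite_covers:
  fixes G :: "nat \<Rightarrow> 'a::metric_space set set"
  assumes fin: "\<And>n. finite (G n)"
    and bdd: "\<And>n U. U \<in> G n \<Longrightarrow> bounded U \<and> diameter U \<le> \<delta>"
    and cover: "A \<subseteq> (\<Union>n. \<Union>(G n))"
    and "\<delta> \<ge> 0"
  shows "hausdorff_premeasure s \<delta> A \<le> (\<Sum>n. ennreal (\<Sum>U\<in>G n. diameter U powr s))"
proof -
  have "\<exists>g. bij_betw g {..<card (G n)} (G n)" for n
    using ex_bij_betw_nat_finite[OF fin] by (simp add: atLeast0LessThan)
  then obtain g where g: "\<And>n. bij_betw (g n) {..<card (G n)} (G n)"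
    by metis
  define V where "V = (\<lambda>(n, j). if j < card (G n) then g n j else {})"
  have V: "bounded (V p) \<and> diameter (V p) \<le> \<delta>" for p
  proof (cases "snd p < card (G (fst p))")
    case True
    then have "V p \<in> G (fst p)"
      using bij_betwE[OF g] by (auto simp: V_def split: prod.splits)
    then show ?thesis
      by (rule bdd)
  next
    case False
    then show ?thesis
      using \<open>\<delta> \<ge> 0\<close> by (simp add: V_def case_prod_beta)
  qed
  have level: "(\<Sum>j. ennreal (diameter (V (n, j)) powr s))
      = ennreal (\<Sum>U\<in>G n. diameter U powr s)" for n
  proof -
    have "(\<Sum>j. ennreal (diameter (V (n, j)) powr s))
        = (\<Sum>j<card (G n). ennreal (diameter (V (n, j)) powr s))"
      \<comment> \<open>The padding costs nothing: \<open>diameter {} = 0\<close>, and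
        \<open>0 powr s = 0\<close> for every real \<open>s\<close>.\<close>
      by (intro suminf_finite) (auto simp: V_def)
    also have "\<dots> = (\<Sum>j<card (G n). ennreal (diameter (g n j) powr s))"
      by (intro sum.cong) (auto simp: V_def)
    also have "\<dots> = (\<Sum>U\<in>G n. ennreal (diameter U powr s))"
      by (rule sum.reindex_bij_betw[OF g])
    finally show ?thesis
      by simp
  qed
  have "A \<subseteq> (\<Union>i. V (prod_decode i))"
  proof
    fix x assume "x \<in> A"
    then obtain n U where "U \<in> G n" "x \<in> U"
      using cover by auto
    then obtain j where "j < card (G n)" "g n j = U"
      using bij_betw_imp_surj_on[OF g[of n]] by (metis imageE lessThan_iff)
    then have "x \<in> V (prod_decode (prod_encode (n, j)))"
      using \<open>x \<in> U\<close> by (simp add: V_def)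
    then show "x \<in> (\<Union>i. V (prod_decode i))"
      by blast
  qed
  then have "hausdorff_premeasure s \<delta> A
      \<le> (\<Sum>i. ennreal (diameter (V (prod_decode i)) powr s))"
    unfolding hausdorff_premeasure_def using V
    by (intro Inf_lower CollectI exI[of _ "\<lambda>i. V (prod_decode i)"] conjI refl) auto
  also have "\<dots> = (\<Sum>n. \<Sum>j. ennreal (diameter (V (n, j)) powr s))"
    by (rule suminf_ennreal_2dimen[where f = "\<lambda>p. ennreal (diameter (V p) powr s)"])
      (rule refl)
  also have "\<dots> = (\<Sum>n. ennreal (\<Sum>U\<in>G n. diameter U powr s))"
    by (simp only: level)
  finally show ?thesis .
qed

text \<open>A point lying in infinitely many levels is still covered after the first
  \<open>M\<close> levels are dropped, and the tail of a convergent series is arbitrarily small. No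
  bound on the diameters is assumed, since the small tail already forces each of its sets to be
  small.\<close>

lemma hausdorff_cantelli:
  fixes G :: "nat \<Rightarrow> 'a::metric_space set set"
  assumes "s > 0"
    and fin: "\<And>n. finite (G n)"
    and bdd: "\<And>n U. U \<in> G n \<Longrightarrow> bounded U"
    and summable: "summable (\<lambda>n. \<Sum>U\<in>G n. diameter U powr s)"
    and limsup: "\<And>x. x \<in> A \<Longrightarrow> infinite {n. x \<in> \<Union>(G n)}"
  shows "hausdorff_measure s A = 0"
proof -
  define a where "a n = (\<Sum>U\<in>G n. diameter U powr s)" for n
  have a_nonneg: "a n \<ge> 0" for n
    unfolding a_def by (intro sum_nonneg) simp
  have summable_a: "summable a"
    using summable unfolding a_def .
  have "hausdorff_premeasure s \<delta> A \<le> 0 + ennreal \<epsilon>" if "\<delta> > 0" "\<epsilon> > 0" for \<delta> \<epsilon>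
  proof -
    \<comment> \<open>The bound \<epsilon> controls the total of the tail. The bound
      \<open>\<delta> powr s\<close> controls the single sets: a set of diameter above \<delta>
      would alone contribute at least that much.\<close>
    define r where "r = min \<epsilon> (\<delta> powr s)"
    have "r > 0"
      using that by (simp add: r_def)
    obtain M where M: "(\<Sum>i. a (i + M)) < r"
      using suminf_exist_split[OF \<open>r > 0\<close> summable_a] a_nonneg
      by (metis abs_of_nonneg order_refl real_norm_def suminf_nonneg summable_a summable_iff_shift)
    have summable_tail: "summable (\<lambda>i. a (i + M))"
      using summable_a by simp
    have "diameter U \<le> \<delta>" if "U \<in> G (n + M)" for n U
    proof (rule ccontr)
      assume "\<not> diameter U \<le> \<delta>"
      then have "\<delta> powr s \<le> diameter U powr s"
        using \<open>\<delta> > 0\<close> \<open>s > 0\<close> by (intro powr_mono2) auto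
      also have "\<dots> \<le> a (n + M)"
        unfolding a_def by (intro member_le_sum that fin) simp
      also have "\<dots> \<le> (\<Sum>i. a (i + M))"
        using sum_le_suminf[OF summable_tail, of "{n}"] a_nonneg by simp
      finally show False
        using M by (simp add: r_def)
    qed
    moreover have "A \<subseteq> (\<Union>n. \<Union>(G (n + M)))"
    proof
      fix x assume "x \<in> A"
      then obtain m where "m \<ge> M" "x \<in> \<Union>(G m)"
        using limsup[of x] unfolding infinite_nat_iff_unbounded_le by blast
      then have "x \<in> \<Union>(G ((m - M) + M))"
        by simp
      then show "x \<in> (\<Union>n. \<Union>(G (n + M)))"
        by blast
    qed
    ultimately have "hausdorff_premeasure s \<delta> A \<le> (\<Sum>n. ennreal (a (n + M)))"
      unfolding a_def using \<open>\<delta> > 0\<close>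
      by (intro hausdorff_premeasure_le_suminf_finite_covers) (auto simp: fin bdd)
    also have "\<dots> = ennreal (\<Sum>n. a (n + M))"
      using a_nonneg summable_tail by (intro suminf_ennreal2)
    also have "\<dots> \<le> ennreal \<epsilon>"
      using M by (intro ennreal_leI) (simp add: r_def)
    finally show ?thesis
      by simp
  qed
  then have "hausdorff_premeasure s \<delta> A = 0" if "\<delta> > 0" for \<delta>
    using ennreal_le_epsilon[of 0] that by (metis le_zero_eq)
  then have "hausdorff_measure s A \<le> 0"
    unfolding hausdorff_measure_def by (intro SUP_least) simp
  then show ?thesis
    by simp
qed

text \<open>A bounded Euclidean set has compact, hence totally bounded, closure. Balls of radius
  \<open>\<delta> / 2\<close> thus give an admissible finite cover, and a non-empty set of naturals
  contains its infimum.\<close>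

lemma covering_number_attained:
  fixes A :: "'a::euclidean_space set"
  assumes "bounded A" "\<delta> > 0"
  obtains F where "finite F" "A \<subseteq> \<Union>F" "\<And>U. U \<in> F \<Longrightarrow> bounded U \<and> diameter U \<le> \<delta>"
    "card F = covering_number \<delta> A"
proof -
  let ?covers = "{F :: 'a set set.
    finite F \<and> A \<subseteq> \<Union>F \<and> (\<forall>U\<in>F. bounded U \<and> diameter U \<le> \<delta>)}"
  have "compact (closure A)"
    using \<open>bounded A\<close> by simp
  then obtain K where "finite K" "closure A \<subseteq> (\<Union>x\<in>K. ball x (\<delta> / 2))"
    using \<open>\<delta> > 0\<close> unfolding compact_eq_totally_bounded by (meson half_gt_zero)
  then have "(\<lambda>x. ball x (\<delta> / 2)) ` K \<in> ?covers"
    using \<open>\<delta> > 0\<close> closure_subset[of A] by (auto simp: diameter_ball)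
  then have "card ` ?covers \<noteq> {}"
    by blast
  then have "Inf (card ` ?covers) \<in> card ` ?covers"
    by (rule Inf_nat_def1)
  moreover have "card ` ?covers = {card F | F. finite F \<and> A \<subseteq> \<Union>F \<and>
      (\<forall>U\<in>F. bounded U \<and> diameter U \<le> \<delta>)}"
    by blast
  ultimately show ?thesis
    using that unfolding covering_number_def by auto
qed

text \<open>This treats one level, with grid spacing \<delta> and radius \<rho>. The factor 4 is
  independent of \<open>\<rho> / \<delta>\<close> because of the case split: for large \<rho> many
  grid points lie near one covering set, but then that set itself is small enough to be
  kept.\<close>

lemma grid_neighbourhood_cover:
  fixes A :: "real set"
  assumes "\<delta> > 0" "\<rho> > 0" "bounded A"
  obtains G where "finite G" "card G \<le> 4 * covering_number \<delta> A"
    "\<And>U. U \<in> G \<Longrightarrow> bounded U \<and> diameter U \<le> 2 * \<rho>"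
    "\<And>x p. x \<in> A \<Longrightarrow> \<bar>x - of_int p * \<delta>\<bar> < \<rho> \<Longrightarrow> x \<in> \<Union>G"
proof -
  obtain F where F: "finite F" "A \<subseteq> \<Union>F" "card F = covering_number \<delta> A"
    "\<And>U. U \<in> F \<Longrightarrow> bounded U \<and> diameter U \<le> \<delta>"
    using covering_number_attained[OF \<open>bounded A\<close> \<open>\<delta> > 0\<close>] by metis
  show ?thesis
  proof (cases "\<delta> \<le> \<rho>")
    case True
    show ?thesis
    proof (rule that[of F])
      show "bounded U \<and> diameter U \<le> 2 * \<rho>" if "U \<in> F" for U
        using F(4)[OF that] True \<open>\<rho> > 0\<close> by auto
    qed (use F in auto)
  next
    case False
    \<comment> \<open>The grid index just left of an arbitrary point of \<open>U\<close>. For empty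
      \<open>U\<close> the choice is unspecified, which only adds harmless balls.\<close>
    define c where "c U = \<lfloor>(SOME u. u \<in> U) / \<delta>\<rfloor>" for U
    define B where "B = (\<lambda>(U, k). ball (of_int (c U + k) * \<delta>) \<rho>)"
    \<comment> \<open>If \<open>x \<in> U\<close> is within \<rho> of \<open>p * \<delta>\<close>,
      the chosen point \<open>u\<close> satisfies \<open>\<bar>u / \<delta> - p\<bar> < 2\<close>,
      strictly because \<open>\<rho> < \<delta>\<close>. As
      \<open>c U \<le> u / \<delta> < c U + 1\<close>, the integer \<open>p - c U\<close> lies
      strictly between -2 and 3, which leaves four values.\<close>
    define G where "G = B ` (F \<times> {-1..2})"
    have "card G \<le> card (F \<times> {-1..2::int})"
      unfolding G_def using F(1) by (intro card_image_le) auto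
    then have card: "card G \<le> 4 * covering_number \<delta> A"
      using F(3) by (simp add: card_cartesian_product mult.commute)
    show ?thesis
    proof (rule that[of G])
      show "bounded U \<and> diameter U \<le> 2 * \<rho>" if "U \<in> G" for U
        using that \<open>\<rho> > 0\<close> by (auto simp: G_def B_def diameter_ball)
    next
      fix x p assume x: "x \<in> A" "\<bar>x - of_int p * \<delta>\<bar> < \<rho>"
      obtain U where U: "U \<in> F" "x \<in> U"
        using F(2) x(1) by auto
      define u where "u = (SOME u. u \<in> U)"
      have "u \<in> U"
        unfolding u_def using U(2) by (rule someI)
      have "\<bar>x - u\<bar> \<le> \<delta>"
        using diameter_bounded_bound[of U x u] F(4)[OF U(1)] U(2) \<open>u \<in> U\<close>
        by (auto simp: dist_real_def)
      then have "\<bar>u - of_int p * \<delta>\<bar> < 2 * \<delta>"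
        using x(2) False by linarith
      then have "\<bar>u / \<delta> - of_int p\<bar> < 2"
        using \<open>\<delta> > 0\<close> by (simp add: abs_less_iff field_simps)
      then have "p - c U \<in> {-1..2}"
        unfolding c_def u_def[symmetric] by simp linarith
      moreover have "x \<in> B (U, p - c U)"
        using x(2) by (simp add: B_def dist_real_def abs_minus_commute)
      ultimately show "x \<in> \<Union>G"
        unfolding G_def using U(1) by blast
    qed (use F(1) card in \<open>auto simp: G_def\<close>)
  qed
qed

text \<open>\<open>W\<close> counts pairs, whereas the Cantelli argument counts levels. At a fixed
  level only finitely many \<open>p\<close> come close enough to \<open>x\<close>, so infinitely
  many pairs need infinitely many levels.\<close>

lemma W_infinite_levels:
  assumes "t \<ge> 2" "x \<in> W t \<psi>"
  shows "infinite {n. \<exists>p. \<bar>x - of_int p / of_int t ^ Suc n\<bar> < \<psi> (Suc n)}"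
proof
  let ?N = "{n. \<exists>p. \<bar>x - of_int p / of_int t ^ Suc n\<bar> < \<psi> (Suc n)}"
  let ?P = "\<lambda>n. {p :: int. \<bar>x - of_int p / of_int t ^ n\<bar> < \<psi> n}"
  assume "finite ?N"
  have "finite (?P n)" for n
  proof (rule finite_subset)
    have pos: "(of_int t :: real) ^ n > 0"
      using \<open>t \<ge> 2\<close> by simp
    show "?P n \<subseteq> {\<lfloor>(x - \<psi> n) * of_int t ^ n\<rfloor>..\<lceil>(x + \<psi> n) * of_int t ^ n\<rceil>}"
    proof
      fix p assume "p \<in> ?P n"
      then have "x - \<psi> n < of_int p / of_int t ^ n" "of_int p / of_int t ^ n < x + \<psi> n"
        by (auto simp: abs_less_iff)
      then have "(x - \<psi> n) * of_int t ^ n < of_int p" "of_int p < (x + \<psi> n) * of_int t ^ n"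
        using pos by (simp_all only: pos_less_divide_eq pos_divide_less_eq)
      then show "p \<in> {\<lfloor>(x - \<psi> n) * of_int t ^ n\<rfloor>..\<lceil>(x + \<psi> n) * of_int t ^ n\<rceil>}"
        by simp linarith
    qed
  qed simp
  then have "finite ((\<lambda>(n, p). (p, n)) ` (SIGMA n:Suc ` ?N. ?P n))"
    using \<open>finite ?N\<close> by (intro finite_imageI finite_SigmaI) auto
  moreover have "{(p, n). n \<ge> 1 \<and> \<bar>x - of_int p / of_int t ^ n\<bar> < \<psi> n}
      \<subseteq> (\<lambda>(n, p). (p, n)) ` (SIGMA n:Suc ` ?N. ?P n)"
  proof clarify
    fix p n assume n: "1 \<le> n" "\<bar>x - of_int p / of_int t ^ n\<bar> < \<psi> n"
    \<comment> \<open>Levels start at 1 and the index set at 0, so level \<open>n\<close> is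
      recorded at \<open>n - 1\<close>.\<close>
    then obtain m where "n = Suc m"
      by (cases n) auto
    then have "n \<in> Suc ` ?N"
      using n(2) by blast
    then have "(n, p) \<in> (SIGMA n:Suc ` ?N. ?P n)"
      using n(2) by blast
    then show "(p, n) \<in> (\<lambda>(n, p). (p, n)) ` (SIGMA n:Suc ` ?N. ?P n)"
      by (rule rev_image_eqI) simp
  qed
  ultimately show False
    using \<open>x \<in> W t \<psi>\<close> finite_subset unfolding W_def by blast
qed

theorem theorem1p4:
  fixes t :: int and A :: "real set" and \<psi> :: "nat \<Rightarrow> real" and s :: real
  assumes "t \<ge> 2"
    and "A \<noteq> {}" and "A \<subseteq> {0..1}"
    and "\<And>n. n \<ge> 1 \<Longrightarrow> \<psi> n > 0"
    and "s > 0"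
    and "summable (\<lambda>n. \<psi> (Suc n) powr s * real (covering_number (1 / of_int t ^ Suc n) A))"
  shows "hausdorff_measure s (W t \<psi> \<inter> A) = 0"
proof -
  \<comment> \<open>This is both the spacing of the grid at level \<open>Suc n\<close> and the
    covering scale in the summability hypothesis.\<close>
  define \<delta> :: "nat \<Rightarrow> real" where "\<delta> n = 1 / of_int t ^ Suc n" for n
  have "bounded A"
    using assms(3) bounded_closed_interval bounded_subset by blast
  have "\<exists>G. finite G \<and> card G \<le> 4 * covering_number (\<delta> n) A \<and>
      (\<forall>U\<in>G. bounded U \<and> diameter U \<le> 2 * \<psi> (Suc n)) \<and>
      (\<forall>x\<in>A. \<forall>p. \<bar>x - of_int p * \<delta> n\<bar> < \<psi> (Suc n) \<longrightarrow> x \<in> \<Union>G)" for n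
  proof -
    have "\<delta> n > 0" "\<psi> (Suc n) > 0"
      using assms(1,4) by (simp_all add: \<delta>_def)
    then show ?thesis
      using grid_neighbourhood_cover[OF _ _ \<open>bounded A\<close>] by metis
  qed
  then obtain G where fin: "\<And>n. finite (G n)"
    and card: "\<And>n. card (G n) \<le> 4 * covering_number (\<delta> n) A"
    and bdd: "\<And>n U. U \<in> G n \<Longrightarrow> bounded U \<and> diameter U \<le> 2 * \<psi> (Suc n)"
    and cover: "\<And>n x p. x \<in> A \<Longrightarrow> \<bar>x - of_int p * \<delta> n\<bar> < \<psi> (Suc n) \<Longrightarrow> x \<in> \<Union>(G n)"
    by metis
  show ?thesis
  proof (rule hausdorff_cantelli[OF \<open>s > 0\<close> fin])
    show "bounded U" if "U \<in> G n" for n U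
      using bdd that by blast
  next
    \<comment> \<open>The 4 comes from the number of sets in \<open>G n\<close>, the
      \<open>2 powr s\<close> from their diameter bound \<open>2 * \<psi> (Suc n)\<close>. Neither
      depends on \<open>n\<close>, so the assumed series dominates.\<close>
    have "norm (\<Sum>U\<in>G n. diameter U powr s)
        \<le> 4 * 2 powr s * (\<psi> (Suc n) powr s * real (covering_number (\<delta> n) A))" for n
    proof -
      have "(\<Sum>U\<in>G n. diameter U powr s) \<le> (\<Sum>U\<in>G n. (2 * \<psi> (Suc n)) powr s)"
        using bdd \<open>s > 0\<close> by (intro sum_mono powr_mono2) (auto simp: diameter_ge_0)
      also have "\<dots> = real (card (G n)) * (2 powr s * \<psi> (Suc n) powr s)"
        using assms(4)[of "Suc n"] by (simp add: powr_mult)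
      also have "\<dots> \<le> real (4 * covering_number (\<delta> n) A) * (2 powr s * \<psi> (Suc n) powr s)"
        using card[of n] by (intro mult_right_mono of_nat_mono) auto
      finally show ?thesis
        by (simp add: sum_nonneg mult_ac)
    qed
    then show "summable (\<lambda>n. \<Sum>U\<in>G n. diameter U powr s)"
      by (rule summable_comparison_test'[OF summable_mult[OF assms(6)[folded \<delta>_def]]])
  next
    fix x assume x: "x \<in> W t \<psi> \<inter> A"
    \<comment> \<open>Since \<open>p / t ^ Suc n\<close> is \<open>p * \<delta> n\<close>, every
      level at which \<open>x\<close> is approximated is a level at which \<open>G n\<close> covers
      \<open>x\<close>.\<close>
    have "{n. \<exists>p. \<bar>x - of_int p / of_int t ^ Suc n\<bar> < \<psi> (Suc n)} \<subseteq> {n. x \<in> \<Union>(G n)}"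
      using x cover by (auto simp: \<delta>_def)
    then show "infinite {n. x \<in> \<Union>(G n)}"
      using W_infinite_levels[OF \<open>t \<ge> 2\<close>] x infinite_super by blast
  qed
qed

end
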